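(* If $m(w,\gamma)$ is linear in $\gamma$ and there is $\alpha_0(x)$ such that $E[\alpha_0(X)^2]<\infty$ and $E[m(W,\gamma)]=E[\alpha_0(X)\gamma(Z)]$ for all $\gamma$ with $E[\gamma(Z)^2]<\infty$, then $$\psi(w,\gamma,\alpha,\theta)=m(w,\gamma)-\theta+\alpha(x)[y-\gamma(z)]$$ is doubly robust.
   Context: $W$ includes a scalar outcome $Y$ with $E[Y^2]<\infty$, right-hand side variables $Z$ (possibly endogenous), and instruments $X$ ($Z$ need not equal $X$). $\gamma_0$ is a function of $Z$ with $E[\gamma_0(Z)^2]<\infty$ satisfying the nonparametric instrumental variables restriction $E[Y-\gamma_0(Z)|X]=0$, and $\theta_0=E[m(W,\gamma_0)]$, where $m(w,\gamma)$ is a functional of a function $\gamma$ of $z$. With $\bar\psi(\gamma,\alpha,\theta)=E[\psi(W,\gamma,\alpha,\theta)]$, $\psi$ is doubly robust if $0=\bar\psi(\gamma,\alpha_0,\theta_0)=\bar\psi(\gamma_0,\alpha,\theta_0)$ for all $\gamma$ with $E[\gamma(Z)^2]<\infty$ and all $\alpha$ with $E[\alpha(X)^2]<\infty$. *)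

theory Defs
  imports "HOL-Probability.Probability"
begin

text \<open>
  The observation is a random element \<open>W\<close> on a probability space \<open>M\<close>; the outcome, the right-hand
  side variables and the instruments are functions \<open>y\<close>, \<open>z\<close>, \<open>x\<close> of its value, so that
  \<open>Y = y (W \<omega>)\<close>, \<open>Z = z (W \<omega>)\<close> and \<open>X = x (W \<omega>)\<close>. They may share components.
\<close>

text \<open>The functions \<open>f\<close> on the range \<open>S\<close> of a random element \<open>V\<close> with \<open>E[f(V)^2] < \<infinity>\<close>;
  they are genuine functions, not equivalence classes.\<close>

definition square_integrable_fns ::
    "'a measure \<Rightarrow> ('a \<Rightarrow> 'b) \<Rightarrow> 'b measure \<Rightarrow> ('b \<Rightarrow> real) set" where
  "square_integrable_fns M V S =
     {f \<in> borel_measurable S. integrable M (\<lambda>\<omega>. (f (V \<omega>))\<^sup>2)}"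

text \<open>\<open>E[U | V] = 0\<close>, with conditioning on the sigma-algebra generated by \<open>V\<close>.\<close>

definition cond_mean_zero ::
    "'a measure \<Rightarrow> ('a \<Rightarrow> real) \<Rightarrow> ('a \<Rightarrow> 'b) \<Rightarrow> 'b measure \<Rightarrow> bool" where
  "cond_mean_zero M U V S \<longleftrightarrow>
     (AE \<omega> in M. real_cond_exp M (vimage_algebra (space M) V S) U \<omega> = 0)"

definition linear_functional_on :: "('z \<Rightarrow> real) set \<Rightarrow> (('z \<Rightarrow> real) \<Rightarrow> real) \<Rightarrow> bool" where
  "linear_functional_on G l \<longleftrightarrow>
     (\<forall>f\<in>G. \<forall>g\<in>G. \<forall>a b. l (\<lambda>t. a * f t + b * g t) = a * l f + b * l g)"

definition psi_bar ::
    "'a measure \<Rightarrow> ('a \<Rightarrow> 'w) \<Rightarrow> ('w \<Rightarrow> ('z \<Rightarrow> real) \<Rightarrow> ('x \<Rightarrow> real) \<Rightarrow> real \<Rightarrow> real)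
      \<Rightarrow> ('z \<Rightarrow> real) \<Rightarrow> ('x \<Rightarrow> real) \<Rightarrow> real \<Rightarrow> real" where
  "psi_bar M W \<psi> \<gamma> \<alpha> \<theta> = (\<integral>\<omega>. \<psi> (W \<omega>) \<gamma> \<alpha> \<theta> \<partial>M)"

text \<open>
  \<open>G\<close> and \<open>A\<close> are the sets over which \<open>\<gamma>\<close> and \<open>\<alpha>\<close> range. Since the Bochner integral of a
  non-integrable function is \<open>0\<close> by convention, existence of the expectations is required
  explicitly.
\<close>

definition doubly_robust ::
    "'a measure \<Rightarrow> ('a \<Rightarrow> 'w) \<Rightarrow> ('z \<Rightarrow> real) set \<Rightarrow> ('x \<Rightarrow> real) set
      \<Rightarrow> ('w \<Rightarrow> ('z \<Rightarrow> real) \<Rightarrow> ('x \<Rightarrow> real) \<Rightarrow> real \<Rightarrow> real)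
      \<Rightarrow> ('z \<Rightarrow> real) \<Rightarrow> ('x \<Rightarrow> real) \<Rightarrow> real \<Rightarrow> bool" where
  "doubly_robust M W G A \<psi> \<gamma>\<^sub>0 \<alpha>\<^sub>0 \<theta>\<^sub>0 \<longleftrightarrow>
     (\<forall>\<gamma>\<in>G. integrable M (\<lambda>\<omega>. \<psi> (W \<omega>) \<gamma> \<alpha>\<^sub>0 \<theta>\<^sub>0) \<and> psi_bar M W \<psi> \<gamma> \<alpha>\<^sub>0 \<theta>\<^sub>0 = 0) \<and>
     (\<forall>\<alpha>\<in>A. integrable M (\<lambda>\<omega>. \<psi> (W \<omega>) \<gamma>\<^sub>0 \<alpha> \<theta>\<^sub>0) \<and> psi_bar M W \<psi> \<gamma>\<^sub>0 \<alpha> \<theta>\<^sub>0 = 0)"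

end

theory Submission
  imports Defs
begin

text \<open>For square-integrable \<alpha> and \<gamma>, the expectation of the moment function
  splits into E[m(W,\<gamma>)] - \<open>\<theta>\<^sub>0\<close> plus
  E[\<alpha>(X)(Y - \<gamma>(Z))]. The instrumental variables restriction makes the residual Y -
  \<open>\<gamma>\<^sub>0\<close>(Z) orthogonal to every square-integrable function of X
  (\<open>cond_mean_zero_integral_mult\<close>). At \<open>\<gamma>\<^sub>0\<close> this kills the
  correction term for every \<alpha>, and the rest vanishes by the choice of
  \<open>\<theta>\<^sub>0\<close>. At \<open>\<alpha>\<^sub>0\<close> the representer property, used
  at both \<gamma> and \<open>\<gamma>\<^sub>0\<close>, turns the plug-in bias E[m(W,\<gamma>)] -
  \<open>\<theta>\<^sub>0\<close> into E[\<open>\<alpha>\<^sub>0\<close>(X)(\<gamma>(Z) -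
  \<open>\<gamma>\<^sub>0\<close>(Z))]; adding the correction cancels \<gamma> and leaves
  E[\<open>\<alpha>\<^sub>0\<close>(X)(Y - \<open>\<gamma>\<^sub>0\<close>(Z))], which is zero by
  the same orthogonality. All expectations exist because products of square-integrable variables are
  integrable (\<open>integrable_mult_square_integrable\<close>).\<close>

lemma integrable_mult_square_integrable:
  fixes f g :: "'a \<Rightarrow> real"
  assumes [measurable]: "f \<in> borel_measurable M" "g \<in> borel_measurable M"
    and "integrable M (\<lambda>\<omega>. (f \<omega>)\<^sup>2)" "integrable M (\<lambda>\<omega>. (g \<omega>)\<^sup>2)"
  shows "integrable M (\<lambda>\<omega>. f \<omega> * g \<omega>)"
proof (rule Bochner_Integration.integrable_bound)
  show "integrable M (\<lambda>\<omega>. (f \<omega>)\<^sup>2 + (g \<omega>)\<^sup>2)"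
    using assms by simp
  show "AE \<omega> in M. norm (f \<omega> * g \<omega>) \<le> norm ((f \<omega>)\<^sup>2 + (g \<omega>)\<^sup>2)"
  proof (rule AE_I2)
    fix \<omega>
    \<comment> \<open>Expand the nonnegative square of |f| - |g|; the factor 2 can then be dropped
      since the product of absolute values is nonnegative.\<close>
    have "2 * (\<bar>f \<omega>\<bar> * \<bar>g \<omega>\<bar>) \<le> (f \<omega>)\<^sup>2 + (g \<omega>)\<^sup>2"
      using sum_squares_bound[of "\<bar>f \<omega>\<bar>" "\<bar>g \<omega>\<bar>"] by (simp add: mult.assoc)
    moreover have "0 \<le> \<bar>f \<omega>\<bar> * \<bar>g \<omega>\<bar>"
      by simp
    ultimately show "norm (f \<omega> * g \<omega>) \<le> norm ((f \<omega>)\<^sup>2 + (g \<omega>)\<^sup>2)"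
      by (simp only: real_norm_def abs_mult)
  qed
qed simp

text \<open>Since \<open>a (V \<omega>)\<close> is measurable for the sigma-algebra generated by
  \<open>V\<close>, integrating it against \<open>U\<close> is the same as integrating it against
  the conditional expectation of \<open>U\<close>, which is zero almost everywhere.\<close>

lemma (in finite_measure) cond_mean_zero_integral_mult:
  assumes V: "V \<in> measurable M S"
    and zero: "cond_mean_zero M U V S"
    and a: "a \<in> borel_measurable S"
    and U: "U \<in> borel_measurable M"
    and int: "integrable M (\<lambda>\<omega>. a (V \<omega>) * U \<omega>)"
  shows "(\<integral>\<omega>. a (V \<omega>) * U \<omega> \<partial>M) = 0"
proof -
  let ?F = "vimage_algebra (space M) V S"
  have "subalgebra M ?F"
    using measurable_sets[OF V] measurable_space[OF V]
    by (auto simp: subalgebra_def sets_vimage_algebra2)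
  \<comment> \<open>Finiteness of \<open>M\<close> supplies the sigma-finiteness on the subalgebra
    that conditional expectation relies on.\<close>
  then interpret finite_measure_subalgebra M ?F
    by unfold_locales
  have "V \<in> measurable ?F S"
    using measurable_space[OF V] by (intro measurable_vimage_algebra1) auto
  then have "(\<lambda>\<omega>. a (V \<omega>)) \<in> borel_measurable ?F"
    using a by measurable
  then have "(\<integral>\<omega>. a (V \<omega>) * U \<omega> \<partial>M) = (\<integral>\<omega>. a (V \<omega>) * real_cond_exp M ?F U \<omega> \<partial>M)"
    using real_cond_exp_intg(2)[OF int _ U] by simp
  also have "\<dots> = 0"
    using zero by (intro integral_eq_zero_AE) (auto simp: cond_mean_zero_def)
  finally show ?thesis .
qed

theorem corollary10:
  fixes M :: "'a measure" and SW :: "'w measure" and SZ :: "'z measure" and SX :: "'x measure"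
    and W :: "'a \<Rightarrow> 'w" and y :: "'w \<Rightarrow> real" and z :: "'w \<Rightarrow> 'z" and x :: "'w \<Rightarrow> 'x"
    and m :: "'w \<Rightarrow> ('z \<Rightarrow> real) \<Rightarrow> real"
    and \<gamma>\<^sub>0 :: "'z \<Rightarrow> real" and \<alpha>\<^sub>0 :: "'x \<Rightarrow> real" and \<theta>\<^sub>0 :: real
  defines "G \<equiv> square_integrable_fns M (\<lambda>\<omega>. z (W \<omega>)) SZ"
    and "A \<equiv> square_integrable_fns M (\<lambda>\<omega>. x (W \<omega>)) SX"
  assumes "prob_space M"
    and "W \<in> measurable M SW"
    and "y \<in> borel_measurable SW" and "z \<in> measurable SW SZ" and "x \<in> measurable SW SX"
    and "integrable M (\<lambda>\<omega>. (y (W \<omega>))\<^sup>2)"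
    and "\<gamma>\<^sub>0 \<in> G"
    and "cond_mean_zero M (\<lambda>\<omega>. y (W \<omega>) - \<gamma>\<^sub>0 (z (W \<omega>))) (\<lambda>\<omega>. x (W \<omega>)) SX"
    and "\<theta>\<^sub>0 = (\<integral>\<omega>. m (W \<omega>) \<gamma>\<^sub>0 \<partial>M)"
    and "\<And>w. w \<in> space SW \<Longrightarrow> linear_functional_on G (m w)"
    and "\<alpha>\<^sub>0 \<in> A"
    and "\<And>\<gamma>. \<gamma> \<in> G \<Longrightarrow> integrable M (\<lambda>\<omega>. m (W \<omega>) \<gamma>) \<and>
            (\<integral>\<omega>. m (W \<omega>) \<gamma> \<partial>M) = (\<integral>\<omega>. \<alpha>\<^sub>0 (x (W \<omega>)) * \<gamma> (z (W \<omega>)) \<partial>M)"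
  shows "doubly_robust M W G A
           (\<lambda>w \<gamma> \<alpha> \<theta>. m w \<gamma> - \<theta> + \<alpha> (x w) * (y w - \<gamma> (z w))) \<gamma>\<^sub>0 \<alpha>\<^sub>0 \<theta>\<^sub>0"
proof -
  interpret prob_space M by fact
  note [measurable] = \<open>W \<in> measurable M SW\<close> \<open>y \<in> borel_measurable SW\<close>
    \<open>z \<in> measurable SW SZ\<close> \<open>x \<in> measurable SW SX\<close>
  note m_int = assms(14)
  have G_meas: "(\<lambda>\<omega>. \<gamma> (z (W \<omega>))) \<in> borel_measurable M"
    and G_sq: "integrable M (\<lambda>\<omega>. (\<gamma> (z (W \<omega>)))\<^sup>2)" if "\<gamma> \<in> G" for \<gamma>
    using that unfolding G_def square_integrable_fns_def by auto
  have A_borel: "\<alpha> \<in> borel_measurable SX"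
    and A_meas: "(\<lambda>\<omega>. \<alpha> (x (W \<omega>))) \<in> borel_measurable M"
    and A_sq: "integrable M (\<lambda>\<omega>. (\<alpha> (x (W \<omega>)))\<^sup>2)" if "\<alpha> \<in> A" for \<alpha>
    using that unfolding A_def square_integrable_fns_def by auto
  have int_y: "integrable M (\<lambda>\<omega>. \<alpha> (x (W \<omega>)) * y (W \<omega>))" if "\<alpha> \<in> A" for \<alpha>
    by (rule integrable_mult_square_integrable) (use that A_meas A_sq assms(8) in simp_all)
  have int_\<gamma>: "integrable M (\<lambda>\<omega>. \<alpha> (x (W \<omega>)) * \<gamma> (z (W \<omega>)))"
    if "\<alpha> \<in> A" "\<gamma> \<in> G" for \<alpha> \<gamma>
    by (rule integrable_mult_square_integrable) (use that A_meas A_sq G_meas G_sq in simp_all)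
  have int_res: "integrable M (\<lambda>\<omega>. \<alpha> (x (W \<omega>)) * (y (W \<omega>) - \<gamma> (z (W \<omega>))))"
    if "\<alpha> \<in> A" "\<gamma> \<in> G" for \<alpha> \<gamma>
    using int_y[OF that(1)] int_\<gamma>[OF that] by (simp add: right_diff_distrib)
  \<comment> \<open>The instrumental variables restriction enters here, with the residual at
    \<open>\<gamma>\<^sub>0\<close> as the variable of conditional mean zero.\<close>
  have orth: "(\<integral>\<omega>. \<alpha> (x (W \<omega>)) * (y (W \<omega>) - \<gamma>\<^sub>0 (z (W \<omega>))) \<partial>M) = 0" if "\<alpha> \<in> A" for \<alpha>
    by (rule cond_mean_zero_integral_mult[where V = "\<lambda>\<omega>. x (W \<omega>)" and S = SX])
      (use that A_borel G_meas int_res \<open>\<gamma>\<^sub>0 \<in> G\<close> assms(10) in simp_all)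
  \<comment> \<open>The constant \<open>\<theta>\<^sub>0\<close> integrates to itself because
    \<open>M\<close> has total mass one.\<close>
  have mean: "(\<integral>\<omega>. m (W \<omega>) \<gamma> - \<theta>\<^sub>0 + \<alpha> (x (W \<omega>)) * (y (W \<omega>) - \<gamma> (z (W \<omega>))) \<partial>M)
      = (\<integral>\<omega>. m (W \<omega>) \<gamma> \<partial>M) - \<theta>\<^sub>0 + (\<integral>\<omega>. \<alpha> (x (W \<omega>)) * (y (W \<omega>) - \<gamma> (z (W \<omega>))) \<partial>M)"
    if "\<alpha> \<in> A" "\<gamma> \<in> G" for \<alpha> \<gamma>
    using m_int[OF that(2)] int_res[OF that] by (simp add: prob_space)
  \<comment> \<open>Write E[m(W,\<gamma>)] and \<open>\<theta>\<^sub>0\<close> as expectations of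
    \<open>\<alpha>\<^sub>0\<close>(X)\<gamma>(Z) and
    \<open>\<alpha>\<^sub>0\<close>(X)\<open>\<gamma>\<^sub>0\<close>(Z). The \<gamma> terms cancel,
    and what remains is \<open>orth\<close> at \<open>\<alpha>\<^sub>0\<close>.\<close>
  have shift: "(\<integral>\<omega>. m (W \<omega>) \<gamma> \<partial>M) - \<theta>\<^sub>0
      + (\<integral>\<omega>. \<alpha>\<^sub>0 (x (W \<omega>)) * (y (W \<omega>) - \<gamma> (z (W \<omega>))) \<partial>M) = 0" if "\<gamma> \<in> G" for \<gamma>
    using m_int[OF that] m_int[OF \<open>\<gamma>\<^sub>0 \<in> G\<close>] orth[OF \<open>\<alpha>\<^sub>0 \<in> A\<close>] assms(11)
      int_y[OF \<open>\<alpha>\<^sub>0 \<in> A\<close>] int_\<gamma>[OF \<open>\<alpha>\<^sub>0 \<in> A\<close> that] int_\<gamma>[OF \<open>\<alpha>\<^sub>0 \<in> A\<close> \<open>\<gamma>\<^sub>0 \<in> G\<close>]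
    by (simp add: right_diff_distrib)
  show ?thesis
    unfolding doubly_robust_def psi_bar_def
  proof (intro conjI ballI)
    fix \<gamma> assume \<gamma>: "\<gamma> \<in> G"
    show "integrable M (\<lambda>\<omega>. m (W \<omega>) \<gamma> - \<theta>\<^sub>0 + \<alpha>\<^sub>0 (x (W \<omega>)) * (y (W \<omega>) - \<gamma> (z (W \<omega>))))"
      using m_int[OF \<gamma>] int_res[OF \<open>\<alpha>\<^sub>0 \<in> A\<close> \<gamma>] by simp
    show "(\<integral>\<omega>. m (W \<omega>) \<gamma> - \<theta>\<^sub>0 + \<alpha>\<^sub>0 (x (W \<omega>)) * (y (W \<omega>) - \<gamma> (z (W \<omega>))) \<partial>M) = 0"
      unfolding mean[OF \<open>\<alpha>\<^sub>0 \<in> A\<close> \<gamma>] by (rule shift[OF \<gamma>])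
  next
    fix \<alpha> assume \<alpha>: "\<alpha> \<in> A"
    show "integrable M (\<lambda>\<omega>. m (W \<omega>) \<gamma>\<^sub>0 - \<theta>\<^sub>0 + \<alpha> (x (W \<omega>)) * (y (W \<omega>) - \<gamma>\<^sub>0 (z (W \<omega>))))"
      using m_int[OF \<open>\<gamma>\<^sub>0 \<in> G\<close>] int_res[OF \<alpha> \<open>\<gamma>\<^sub>0 \<in> G\<close>] by simp
    \<comment> \<open>The plug-in part cancels by the definition of \<open>\<theta>\<^sub>0\<close>,
      and the correction vanishes by orthogonality whatever \<alpha> is.\<close>
    show "(\<integral>\<omega>. m (W \<omega>) \<gamma>\<^sub>0 - \<theta>\<^sub>0 + \<alpha> (x (W \<omega>)) * (y (W \<omega>) - \<gamma>\<^sub>0 (z (W \<omega>))) \<partial>M) = 0"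
      unfolding mean[OF \<alpha> \<open>\<gamma>\<^sub>0 \<in> G\<close>] using orth[OF \<alpha>] assms(11) by simp
  qed
qed

end
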